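(* Let $n > 2$ be an integer and let $k > \max(5,(n-1)^2)$ be an integer. Then $$a^r_n(k) = 2a^r_n(k-1)-a^r_n(k-2).$$
   Context: For integers $n\geq 1$ and $k\geq 0$, the $n$ by $k$ grid is the set of points $\{1,\dots,n\}\times\{1,\dots,k\}\subset\mathbb{R}^2$ (empty if $k=0$). $a^r_n(k)$ denotes the number of right isosceles triangles of nonzero area formed by 3 distinct points of the $n$ by $k$ grid, i.e. the number of 3-element non-collinear subsets of the grid that are the vertices of a triangle with at least two sides of equal Euclidean length and with one angle equal to $90^\circ$. *)

theory Defs
  imports "HOL-Analysis.Analysis"
begin

text \<open>The product type \<^typ>\<open>real \<times> real\<close> carries the Euclidean metric and inner product.\<close>

definition grid :: "nat \<Rightarrow> nat \<Rightarrow> (real \<times> real) set" where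
  "grid n k = (\<lambda>(i, j). (real i, real j)) ` ({1..n} \<times> {1..k})"

text \<open>The angle at the middle argument; only meaningful if \<open>p\<close> and \<open>r\<close> both differ from \<open>q\<close>.\<close>

definition angle :: "real \<times> real \<Rightarrow> real \<times> real \<Rightarrow> real \<times> real \<Rightarrow> real" where
  "angle p q r = arccos (((p - q) \<bullet> (r - q)) / (norm (p - q) * norm (r - q)))"

definition isosceles :: "(real \<times> real) set \<Rightarrow> bool" where
  "isosceles T \<longleftrightarrow> (\<exists>p q r. T = {p, q, r} \<and> dist p q = dist q r)"

definition right_angled :: "(real \<times> real) set \<Rightarrow> bool" where
  "right_angled T \<longleftrightarrow> (\<exists>p q r. T = {p, q, r} \<and> angle p q r = pi / 2)"

text \<open>
  A triangle is represented by its set of vertices. The predicates \<^const>\<open>isosceles\<close> and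
  \<^const>\<open>right_angled\<close> are only applied to sets of exactly three points, so that \<open>p\<close>, \<open>q\<close>, \<open>r\<close>
  in their definitions are distinct; any two sides of a triangle share a vertex \<open>q\<close>.
\<close>

definition right_isosceles_triangles :: "nat \<Rightarrow> nat \<Rightarrow> (real \<times> real) set set" where
  "right_isosceles_triangles n k =
    {T. T \<subseteq> grid n k \<and> card T = 3 \<and> \<not> collinear T \<and> isosceles T \<and> right_angled T}"

definition a_r :: "nat \<Rightarrow> nat \<Rightarrow> nat" where
  "a_r n k = card (right_isosceles_triangles n k)"

end

theory Submission
  imports Defs
begin

text \<open>
  A right isosceles triangle with legs \<open>u\<close>, \<open>v\<close> has \<open>v = \<plusminus>(-u\<^sub>2, u\<^sub>1)\<close>, so the vertical components of the
  legs are, up to sign, their horizontal components. In a grid of width \<open>n\<close> these are at most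
  \<open>n - 1\<close>, hence any two vertices differ in height by at most \<open>2 (n - 1)\<close>, however tall the grid is
  (\<open>right_isosceles_height_le\<close>). The hypothesis on \<open>k\<close> makes this less than \<open>k - 1\<close>: for \<open>n = 3\<close>
  because \<open>4 < 5\<close>, and for larger \<open>n\<close> because \<open>2 (n - 1) < (n - 1)\<^sup>2\<close>.

  Consequently no triangle of the \<open>n\<close> by \<open>k\<close> grid meets both the bottom row and the top row, so
  each lies in the lowest \<open>k - 1\<close> rows or in the highest \<open>k - 1\<close> rows. By translation invariance
  both families have \<^term>\<open>a_r n (k - 1)\<close> members, and their intersection, the triangles in the
  middle \<open>k - 2\<close> rows, has \<^term>\<open>a_r n (k - 2)\<close>. Inclusion-exclusion gives the recurrence.
\<close>

text \<open>The underlying set is arbitrary because the highest \<open>k - 1\<close> rows are a translate of a grid.\<close>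

definition right_isosceles_in :: "(real \<times> real) set \<Rightarrow> (real \<times> real) set set" where
  "right_isosceles_in S =
    {T. T \<subseteq> S \<and> card T = 3 \<and> \<not> collinear T \<and> isosceles T \<and> right_angled T}"

lemma right_isosceles_triangles_eq: "right_isosceles_triangles n k = right_isosceles_in (grid n k)"
  by (simp add: right_isosceles_triangles_def right_isosceles_in_def)

lemma right_isosceles_in_Int:
  "right_isosceles_in (A \<inter> B) = right_isosceles_in A \<inter> right_isosceles_in B"
  by (auto simp: right_isosceles_in_def)

lemma finite_right_isosceles_in: "finite S \<Longrightarrow> finite (right_isosceles_in S)"
  by (rule finite_subset[of _ "Pow S"]) (auto simp: right_isosceles_in_def)

lemma isosceles_translation:
  assumes "isosceles T"
  shows "isosceles ((+) a ` T)"
proof -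
  obtain p q r where "T = {p, q, r}" "dist p q = dist q r"
    using assms by (auto simp: isosceles_def)
  then have "(+) a ` T = {a + p, a + q, a + r}" "dist (a + p) (a + q) = dist (a + q) (a + r)"
    by simp_all
  then show ?thesis
    unfolding isosceles_def by blast
qed

lemma right_angled_translation:
  assumes "right_angled T"
  shows "right_angled ((+) a ` T)"
proof -
  obtain p q r where "T = {p, q, r}" "angle p q r = pi / 2"
    using assms by (auto simp: right_angled_def)
  then have "(+) a ` T = {a + p, a + q, a + r}" "angle (a + p) (a + q) (a + r) = pi / 2"
    by (simp_all add: angle_def)
  then show ?thesis
    unfolding right_angled_def by blast
qed

lemma collinear_translation_iff:
  fixes S :: "'a::real_vector set"
  shows "collinear ((+) a ` S) \<longleftrightarrow> collinear S"
  by (simp add: collinear_def)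

lemma right_isosceles_in_translation_member:
  assumes "T \<in> right_isosceles_in S"
  shows "(+) a ` T \<in> right_isosceles_in ((+) a ` S)"
  using assms
  by (simp add: right_isosceles_in_def card_image collinear_translation_iff image_mono
      isosceles_translation right_angled_translation)

lemma right_isosceles_in_translation:
  "right_isosceles_in ((+) a ` S) = (`) ((+) a) ` right_isosceles_in S"
proof (intro equalityI subsetI)
  fix T assume "T \<in> right_isosceles_in ((+) a ` S)"
  then have "(+) (- a) ` T \<in> right_isosceles_in S"
    using right_isosceles_in_translation_member[of T "(+) a ` S" "- a"] by (simp add: image_image)
  moreover have "T = (+) a ` (+) (- a) ` T"
    by (simp add: image_image)
  ultimately show "T \<in> (`) ((+) a) ` right_isosceles_in S"
    by blast
next
  fix T assume "T \<in> (`) ((+) a) ` right_isosceles_in S"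
  then show "T \<in> right_isosceles_in ((+) a ` S)"
    using right_isosceles_in_translation_member[of _ S a] by auto
qed

lemma card_right_isosceles_in_translation:
  "card (right_isosceles_in ((+) a ` S)) = card (right_isosceles_in S)"
  unfolding right_isosceles_in_translation
  by (rule card_image) (auto simp: inj_on_def inj_image_eq_iff)

text \<open>
  As \<^const>\<open>arccos\<close> is only specified on \<open>[-1, 1]\<close>, Cauchy-Schwarz is what permits inverting it.
  If \<open>p = q\<close> or \<open>r = q\<close>, the quotient is \<open>0 / 0 = 0\<close> and the inner product vanishes as well.
\<close>

lemma angle_eq_pi_half_imp_orthogonal:
  assumes "angle p q r = pi / 2"
  shows "(p - q) \<bullet> (r - q) = 0"
proof -
  define x where "x = ((p - q) \<bullet> (r - q)) / (norm (p - q) * norm (r - q))"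
  have "\<bar>x\<bar> \<le> 1"
    using Cauchy_Schwarz_ineq2[of "p - q" "r - q"]
    by (auto simp: x_def abs_divide abs_mult divide_le_eq_1 zero_less_mult_iff)
  then have "x = cos (arccos x)"
    by (simp add: cos_arccos_abs)
  also have "\<dots> = 0"
    unfolding assms[unfolded angle_def, folded x_def] by (rule cos_pi_half)
  finally show ?thesis
    by (auto simp: x_def)
qed

text \<open>
  The definition of \<^const>\<open>isosceles\<close> leaves the apex open. By Pythagoras the hypotenuse is strictly
  longer than either leg, so the two equal sides can only be the legs.
\<close>

lemma right_isosceles_inE:
  assumes "T \<in> right_isosceles_in S"
  obtains p q r where "T = {p, q, r}" "p \<noteq> q" "(p - q) \<bullet> (r - q) = 0" "norm (p - q) = norm (r - q)"
proof -
  have T: "card T = 3" "isosceles T" "right_angled T"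
    using assms by (auto simp: right_isosceles_in_def)
  obtain p q r where pqr: "T = {p, q, r}" "angle p q r = pi / 2"
    using T(3) by (auto simp: right_angled_def)
  have dist: "p \<noteq> q" "q \<noteq> r" "p \<noteq> r"
    using T(1) pqr(1) by (auto simp: card_insert_if split: if_splits)
  have orth: "(p - q) \<bullet> (r - q) = 0"
    by (rule angle_eq_pi_half_imp_orthogonal[OF pqr(2)])
  have "(dist p r)\<^sup>2 = (dist p q)\<^sup>2 + (dist q r)\<^sup>2"
    using orth norm_add_Pythagorean[of "p - q" "q - r"]
    by (simp add: orthogonal_def dist_norm inner_diff_right)
  moreover have "0 < (dist p q)\<^sup>2" "0 < (dist q r)\<^sup>2"
    using dist by simp_all
  ultimately have "(dist p q)\<^sup>2 < (dist p r)\<^sup>2" "(dist q r)\<^sup>2 < (dist p r)\<^sup>2"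
    by linarith+
  then have hyp: "dist p q < dist p r" "dist q r < dist p r"
    by (blast intro: power2_less_imp_less zero_le_dist)+
  obtain p' q' r' where iso: "T = {p', q', r'}" "dist p' q' = dist q' r'"
    using T(2) by (auto simp: isosceles_def)
  have dist': "p' \<noteq> q'" "q' \<noteq> r'" "p' \<noteq> r'"
    using T(1) iso(1) by (auto simp: card_insert_if split: if_splits)
  have "p' \<in> {p, q, r}" "q' \<in> {p, q, r}" "r' \<in> {p, q, r}"
    unfolding pqr(1)[symmetric] iso(1) by simp_all
  then have "dist p q = dist q r"
    using dist' hyp iso(2) by (elim insertE emptyE) (simp_all add: dist_commute)
  then have "norm (p - q) = norm (r - q)"
    by (simp add: dist_norm norm_minus_commute)
  then show thesis
    using that pqr(1) dist(1) orth by blast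
qed

text \<open>
  Orthogonality reads \<open>u\<^sub>1 v\<^sub>1 = - u\<^sub>2 v\<^sub>2\<close>. With \<open>s\<close> the common squared length, squaring turns
  this into \<open>u\<^sub>1\<^sup>2 v\<^sub>1\<^sup>2 = (s - u\<^sub>1\<^sup>2) (s - v\<^sub>1\<^sup>2)\<close>, that is, \<open>s (s - u\<^sub>1\<^sup>2 - v\<^sub>1\<^sup>2) = 0\<close>.
\<close>

lemma orthogonal_same_norm_swaps_coordinates:
  fixes u v :: "real \<times> real"
  assumes "u \<noteq> 0" "u \<bullet> v = 0" "norm u = norm v"
  shows "\<bar>snd u\<bar> = \<bar>fst v\<bar>" and "\<bar>snd v\<bar> = \<bar>fst u\<bar>"
proof -
  define s where "s = (norm u)\<^sup>2"
  have s: "s = (fst u)\<^sup>2 + (snd u)\<^sup>2" "s = (fst v)\<^sup>2 + (snd v)\<^sup>2"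
    using assms(3) by (simp_all add: s_def norm_prod_def)
  have "s \<noteq> 0"
    using assms(1) by (simp add: s_def)
  have "fst u * fst v = - (snd u * snd v)"
    using assms(2) by (simp add: inner_prod_def)
  then have "(fst u)\<^sup>2 * (fst v)\<^sup>2 = (snd u)\<^sup>2 * (snd v)\<^sup>2"
    by (metis power2_minus power_mult_distrib)
  also have "\<dots> = (s - (fst u)\<^sup>2) * (s - (fst v)\<^sup>2)"
    using s by simp
  finally have "s * (s - (fst u)\<^sup>2 - (fst v)\<^sup>2) = 0"
    by (simp add: algebra_simps power2_eq_square)
  then have "s = (fst u)\<^sup>2 + (fst v)\<^sup>2"
    using \<open>s \<noteq> 0\<close> by simp
  then have "(snd u)\<^sup>2 = (fst v)\<^sup>2" "(snd v)\<^sup>2 = (fst u)\<^sup>2"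
    using s by simp_all
  then show "\<bar>snd u\<bar> = \<bar>fst v\<bar>" "\<bar>snd v\<bar> = \<bar>fst u\<bar>"
    by (simp_all add: power2_eq_iff abs_eq_iff)
qed

text \<open>
  The height difference between the ends of the hypotenuse is the difference of the vertical
  components of the two legs, each of which is bounded by the width; this is the source of the
  factor 2.
\<close>

lemma right_isosceles_height_le:
  assumes T: "T \<in> right_isosceles_in S"
    and width: "\<And>x y. x \<in> S \<Longrightarrow> y \<in> S \<Longrightarrow> \<bar>fst x - fst y\<bar> \<le> w"
    and xy: "x \<in> T" "y \<in> T"
  shows "\<bar>snd x - snd y\<bar> \<le> 2 * w"
proof -
  obtain p q r where T_eq: "T = {p, q, r}"
    and legs: "p \<noteq> q" "(p - q) \<bullet> (r - q) = 0" "norm (p - q) = norm (r - q)"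
    using right_isosceles_inE[OF T] by blast
  have swap: "\<bar>snd p - snd q\<bar> = \<bar>fst r - fst q\<bar>" "\<bar>snd r - snd q\<bar> = \<bar>fst p - fst q\<bar>"
    using orthogonal_same_norm_swaps_coordinates[of "p - q" "r - q"] legs by simp_all
  have "{p, q, r} \<subseteq> S"
    using T T_eq by (auto simp: right_isosceles_in_def)
  then have "\<bar>snd p - snd q\<bar> \<le> w" "\<bar>snd r - snd q\<bar> \<le> w"
    unfolding swap using width by auto
  then show ?thesis
    using xy T_eq by (auto simp: abs_le_iff)
qed

lemma mem_grid_iff:
  "x \<in> grid n k \<longleftrightarrow> (\<exists>i j. x = (real i, real j) \<and> 1 \<le> i \<and> i \<le> n \<and> 1 \<le> j \<and> j \<le> k)"
  by (auto simp: grid_def)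

lemma mem_grid_shift_iff:
  "x \<in> (+) (0, 1) ` grid n k \<longleftrightarrow>
    (\<exists>i j. x = (real i, real j) \<and> 1 \<le> i \<and> i \<le> n \<and> 2 \<le> j \<and> j \<le> Suc k)"
proof
  assume "x \<in> (+) (0, 1) ` grid n k"
  then obtain i j where "x = (real i, real (Suc j))" "1 \<le> i" "i \<le> n" "1 \<le> j" "j \<le> k"
    by (auto simp: mem_grid_iff)
  then show "\<exists>i j. x = (real i, real j) \<and> 1 \<le> i \<and> i \<le> n \<and> 2 \<le> j \<and> j \<le> Suc k"
    by (intro exI[of _ i] exI[of _ "Suc j"]) auto
next
  assume "\<exists>i j. x = (real i, real j) \<and> 1 \<le> i \<and> i \<le> n \<and> 2 \<le> j \<and> j \<le> Suc k"
  then obtain i j where x: "x = (real i, real j)" "1 \<le> i" "i \<le> n" "2 \<le> j" "j \<le> Suc k"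
    by blast
  then have "x = (0, 1) + (real i, real (j - 1))"
    by (simp add: of_nat_diff)
  moreover have "(real i, real (j - 1)) \<in> grid n k"
    unfolding mem_grid_iff using x by (intro exI[of _ i] exI[of _ "j - 1"]) auto
  ultimately show "x \<in> (+) (0, 1) ` grid n k"
    by blast
qed

lemma grid_Int_shift: "grid n (Suc m) \<inter> (+) (0, 1) ` grid n (Suc m) = (+) (0, 1) ` grid n m"
proof (rule set_eqI)
  fix x
  show "x \<in> grid n (Suc m) \<inter> (+) (0, 1) ` grid n (Suc m) \<longleftrightarrow> x \<in> (+) (0, 1) ` grid n m"
    unfolding Int_iff mem_grid_iff mem_grid_shift_iff by fastforce
qed

lemma right_isosceles_in_grid_split:
  assumes "2 * (n - 1) < Suc m"
  shows "right_isosceles_in (grid n (Suc (Suc m))) =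
    right_isosceles_in (grid n (Suc m)) \<union> right_isosceles_in ((+) (0, 1) ` grid n (Suc m))"
    (is "?G = ?A \<union> ?B")
proof
  have lower: "grid n (Suc m) \<subseteq> grid n (Suc (Suc m))"
    by (force simp: grid_def)
  have upper: "(+) (0, 1) ` grid n (Suc m) \<subseteq> grid n (Suc (Suc m))"
    by (force simp: grid_def)
  show "?A \<union> ?B \<subseteq> ?G"
    unfolding right_isosceles_in_def using lower upper by blast
  show "?G \<subseteq> ?A \<union> ?B"
  proof (rule subsetI, rule ccontr)
    fix T assume T: "T \<in> ?G" and notin: "T \<notin> ?A \<union> ?B"
    have sub: "T \<subseteq> grid n (Suc (Suc m))"
      using T by (simp add: right_isosceles_in_def)
    have "\<not> T \<subseteq> grid n (Suc m)" "\<not> T \<subseteq> (+) (0, 1) ` grid n (Suc m)"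
      using T notin by (auto simp: right_isosceles_in_def)
    then obtain x y where x: "x \<in> T" "x \<notin> grid n (Suc m)"
      and y: "y \<in> T" "y \<notin> (+) (0, 1) ` grid n (Suc m)"
      by blast
    obtain i j where ij: "x = (real i, real j)" "1 \<le> i" "i \<le> n" "1 \<le> j" "j \<le> Suc (Suc m)"
      using x sub mem_grid_iff by blast
    obtain i' j' where ij': "y = (real i', real j')" "1 \<le> i'" "i' \<le> n" "1 \<le> j'" "j' \<le> Suc (Suc m)"
      using y sub mem_grid_iff by blast
    have "\<not> j \<le> Suc m"
      using ij x(2) by (auto simp: mem_grid_iff)
    then have top: "snd x = real (Suc (Suc m))"
      using ij by simp
    have "\<not> 2 \<le> j'"
      using ij' y(2) by (auto simp: mem_grid_shift_iff)
    then have bottom: "snd y = 1"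
      using ij' by simp
    have "\<bar>snd x - snd y\<bar> \<le> 2 * real (n - 1)"
      by (rule right_isosceles_height_le[OF T _ x(1) y(1)]) (auto simp: mem_grid_iff)
    then have "real (Suc m) \<le> real (2 * (n - 1))"
      using top bottom by simp
    then show False
      using assms by linarith
  qed
qed

lemma a_r_recurrence:
  assumes "2 * (n - 1) < Suc m"
  shows "a_r n (Suc (Suc m)) + a_r n m = 2 * a_r n (Suc m)"
proof -
  let ?A = "right_isosceles_in (grid n (Suc m))"
  let ?B = "right_isosceles_in ((+) (0, 1) ` grid n (Suc m))"
  have fin: "finite ?A" "finite ?B"
    by (auto intro!: finite_right_isosceles_in simp: grid_def)
  have "card ?A + card ?B = card (?A \<union> ?B) + card (?A \<inter> ?B)"
    by (rule card_Un_Int[OF fin])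
  then show ?thesis
    unfolding right_isosceles_in_Int[symmetric] grid_Int_shift
      right_isosceles_in_grid_split[OF assms, symmetric]
      card_right_isosceles_in_translation
    by (simp add: a_r_def right_isosceles_triangles_eq)
qed

theorem theorem11:
  fixes n k :: nat
  assumes "n > 2" and "k > max 5 ((n - 1)\<^sup>2)"
  shows "int (a_r n k) = 2 * int (a_r n (k - 1)) - int (a_r n (k - 2))"
proof -
  define m where "m = k - 2"
  have k: "k = Suc (Suc m)"
    using assms(2) unfolding m_def by linarith
  have "2 * (n - 1) < Suc m"
    \<comment> \<open>At \<open>n = 3\<close> the square equals \<open>2 (n - 1)\<close>, so strictness comes from \<open>k > 5\<close>.\<close>
  proof (cases "n = 3")
    case True
    then show ?thesis
      using assms(2) k by simp
  next
    case False
    then have "2 * (n - 1) < (n - 1) * (n - 1)"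
      using assms(1) by (intro mult_strict_right_mono) auto
    moreover have "(n - 1) * (n - 1) < k"
      using assms(2) by (simp add: power2_eq_square)
    ultimately show ?thesis
      using k by linarith
  qed
  then show ?thesis
    using a_r_recurrence[of n m] k by simp
qed

end
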